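(* For $x>0$, $$-\sum_{m=1}^{\infty}\frac{\psi'(mx+1)}{m^2}+\sum_{m=1}^{\infty}\frac{\psi'\left(\frac{m}{x}+1\right)}{m^2}+\frac{2}{x}\sum_{m=1}^{\infty}\frac{\gamma+\psi(mx+1)}{m^3}=\zeta^2(2).$$
   Context: $\zeta$ is the Riemann zeta function, $\gamma$ is Euler's constant, $\psi=\Gamma'/\Gamma$ is the digamma function and $\psi'$ its derivative. $\zeta^2(2)$ means $(\zeta(2))^2$. *)

theory Defs
  imports "HOL-Analysis.Analysis"
begin

definition zeta_series :: "complex \<Rightarrow> complex" where
  "zeta_series s = (\<Sum>n. 1 / of_nat (Suc n) powr s)"

text \<open>
  The Riemann zeta function: the Dirichlet series where it converges absolutely, and elsewhere
  its holomorphic continuation to the plane punctured at 1, which is unique by the identity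
  theorem. The value at the pole 1 is unspecified.
\<close>

definition riemann_zeta :: "complex \<Rightarrow> complex" where
  "riemann_zeta s =
     (if Re s > 1 then zeta_series s
      else (THE w. \<exists>f. f holomorphic_on (- {1}) \<and>
                       (\<forall>z. Re z > 1 \<longrightarrow> f z = zeta_series z) \<and> w = f s))"

end

theory Submission
  imports Defs
begin

text \<open>
  Expand \<open>\<psi>'(y + 1) = (\<Sum>n\<ge>1. 1 / (y + n)\<^sup>2)\<close> and \<open>\<gamma> + \<psi>(y + 1) = (\<Sum>n\<ge>1. y / (n (n + y)))\<close>,
  and interchange \<open>m\<close> and \<open>n\<close> in the double series of the second sum. The three double series
  then combine termwise, because
  \<open>- n\<^sup>2 + x\<^sup>2 m\<^sup>2 + 2 n (n + m x) = (n + m x)\<^sup>2\<close>, into \<open>\<Sum>1 / (m\<^sup>2 n\<^sup>2) = \<zeta>(2)\<^sup>2\<close>.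
\<close>

lemma deriv_Digamma_sums:
  fixes y :: real
  assumes "y \<ge> 0"
  shows "(\<lambda>k. 1 / (y + real (Suc k))\<^sup>2) sums deriv Digamma (y + 1)"
proof -
  have "y + 1 \<notin> \<int>\<^sub>\<le>\<^sub>0"
    using assms by (auto elim!: nonpos_Ints_cases)
  then have "(Digamma has_field_derivative Polygamma (Suc 0) (y + 1)) (at (y + 1))"
    by (intro has_field_derivative_Polygamma)
  then have "deriv Digamma (y + 1) = Polygamma 1 (y + 1)"
    by (simp add: DERIV_imp_deriv)
  moreover have "(\<lambda>k. inverse ((y + 1 + real k) ^ Suc 1)) sums ((-1) ^ Suc 1 * Polygamma 1 (y + 1) / fact 1)"
    using assms by (intro Polygamma_LIMSEQ) auto
  ultimately show ?thesis
    by (simp add: field_simps power2_eq_square)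
qed

lemma euler_mascheroni_plus_Digamma_sums:
  fixes y :: real
  assumes "y \<ge> 0"
  shows "(\<lambda>k. y / (real (Suc k) * (real (Suc k) + y))) sums (euler_mascheroni + Digamma (y + 1))"
proof -
  \<comment> \<open>This is the defining series of \<open>Digamma\<close> at \<open>y + 1\<close>,
    with the constant \<open>- euler_mascheroni\<close> moved to the other side.\<close>
  have "(\<lambda>k. inverse (real (Suc k)) - inverse (y + 1 + real k)) sums (euler_mascheroni + Digamma (y + 1))"
    using summable_sums[OF summable_Digamma[of "y + 1"]] assms by (simp add: Digamma_def)
  moreover have "inverse (real (Suc k)) - inverse (y + 1 + real k) = y / (real (Suc k) * (real (Suc k) + y))" for k
    using assms by (simp add: divide_simps add_nonneg_eq_0_iff)
  ultimately show ?thesis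
    by simp
qed

text \<open>Bridge from unordered to iterated sums: nonnegative rows converge unconditionally, so
  \<open>has_sum_SigmaD\<close> can sum by rows. On the unordered side, exchanging \<open>m\<close>
  and \<open>n\<close> is a mere reindexing.\<close>

lemma row_sums_sums_infsum:
  fixes f :: "nat \<times> nat \<Rightarrow> real"
  assumes "f summable_on UNIV" and "\<And>p. f p \<ge> 0"
    and "\<And>m. (\<lambda>n. f (m, n)) sums g m"
  shows "g sums infsum f UNIV"
proof -
  have "(f has_sum infsum f UNIV) (Sigma UNIV (\<lambda>_. UNIV))"
    using assms(1) by simp
  then have "(g has_sum infsum f UNIV) UNIV"
    by (rule has_sum_SigmaD) (intro sums_nonneg_imp_has_sum assms(2,3))
  then show ?thesis
    by (rule has_sum_imp_sums)
qed

lemma inverse_squares_summable: "summable (\<lambda>n. 1 / (real (Suc n))\<^sup>2)"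
  using inverse_squares_sums by (simp add: sums_iff add.commute)

lemma zeta_2_eq: "riemann_zeta 2 = complex_of_real (\<Sum>n. 1 / (real (Suc n))\<^sup>2)"
proof -
  have "1 / complex_of_nat (Suc n) powr 2 = complex_of_real (1 / (real (Suc n))\<^sup>2)" for n
    by (simp add: powr_nat' del: of_nat_Suc)
  then show ?thesis
    by (simp add: riemann_zeta_def zeta_series_def suminf_of_real[OF inverse_squares_summable] del: of_nat_Suc)
qed

text \<open>Besides giving the right-hand side of the identity, this family is the majorant that
  makes the other double series summable.\<close>

lemma inverse_squares_product_has_sum:
  "((\<lambda>(m, n). 1 / ((real (Suc m))\<^sup>2 * (real (Suc n))\<^sup>2)) has_sum (\<Sum>n. 1 / (real (Suc n))\<^sup>2)\<^sup>2) UNIV"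
proof -
  define Z where "Z = (\<Sum>n. 1 / (real (Suc n))\<^sup>2)"
  define p where "p = (\<lambda>(m, n). 1 / ((real (Suc m))\<^sup>2 * (real (Suc n))\<^sup>2))"
  have Z: "(\<lambda>n. 1 / (real (Suc n))\<^sup>2) sums Z"
    using inverse_squares_summable unfolding Z_def by (rule summable_sums)
  have row: "(\<lambda>n. p (m, n)) sums (1 / (real (Suc m))\<^sup>2 * Z)" for m
    using sums_mult[OF Z, of "1 / (real (Suc m))\<^sup>2"] by (simp add: p_def del: of_nat_Suc)
  have rows: "(\<lambda>m. 1 / (real (Suc m))\<^sup>2 * Z) sums (Z * Z)"
    using sums_mult2[OF Z] .
  have nonneg: "p q \<ge> 0" for q
    by (simp add: p_def split: prod.split)
  have "Z \<ge> 0"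
    unfolding Z_def by (intro suminf_nonneg inverse_squares_summable) simp
  then have "(\<lambda>m. 1 / (real (Suc m))\<^sup>2 * Z) summable_on UNIV"
    using rows by (intro summable_nonneg_imp_summable_on) (auto simp: sums_iff)
  moreover have "((\<lambda>n. p (m, n)) has_sum 1 / (real (Suc m))\<^sup>2 * Z) UNIV" for m
    using row nonneg by (intro sums_nonneg_imp_has_sum)
  \<comment> \<open>For nonnegative terms, summable row sums already give joint summability; the
    value then follows by summing the rows again.\<close>
  ultimately have "p summable_on (UNIV \<times> UNIV)"
    using nonneg by (intro summable_on_SigmaI)
  then have summ: "p summable_on UNIV"
    by simp
  have "infsum p UNIV = Z * Z"
    using row_sums_sums_infsum[OF summ nonneg row] rows by (rule sums_unique2)
  then show ?thesis
    using has_sum_infsum[OF summ] by (simp add: p_def Z_def power2_eq_square)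
qed

theorem mainTheorem6:
  fixes x :: real
  assumes "x > 0"
  shows "summable (\<lambda>n. deriv Digamma (real (Suc n) * x + 1) / real (Suc n) ^ 2) \<and>
         summable (\<lambda>n. deriv Digamma (real (Suc n) / x + 1) / real (Suc n) ^ 2) \<and>
         summable (\<lambda>n. (euler_mascheroni + Digamma (real (Suc n) * x + 1)) / real (Suc n) ^ 3) \<and>
         complex_of_real
           (- (\<Sum>n. deriv Digamma (real (Suc n) * x + 1) / real (Suc n) ^ 2)
            + (\<Sum>n. deriv Digamma (real (Suc n) / x + 1) / real (Suc n) ^ 2)
            + 2 / x * (\<Sum>n. (euler_mascheroni + Digamma (real (Suc n) * x + 1)) / real (Suc n) ^ 3))
         = (riemann_zeta 2) ^ 2"
proof -
  define p :: "nat \<times> nat \<Rightarrow> real"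
    where "p = (\<lambda>(m, n). 1 / ((real (Suc m))\<^sup>2 * (real (Suc n))\<^sup>2))"
  \<comment> \<open>Row \<open>m\<close> of \<open>a y\<close> expands the \<open>m\<close>-th term
    of a trigamma series: \<open>y = x\<close> serves the first sum and \<open>y = 1 / x\<close> the
    second. The rows of \<open>c\<close> expand the third sum.\<close>
  define a where "a y = (\<lambda>(m, n). 1 / (y * real (Suc m) + real (Suc n))\<^sup>2 / (real (Suc m))\<^sup>2)" for y :: real
  define c where "c = (\<lambda>(m, n). real (Suc m) * x / (real (Suc n) * (real (Suc n) + real (Suc m) * x)) / real (Suc m) ^ 3)"
  define Z where "Z = (\<Sum>n. 1 / (real (Suc n))\<^sup>2)"
  note [simp del] = of_nat_Suc
  have p: "(p has_sum Z\<^sup>2) UNIV"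
    using inverse_squares_product_has_sum by (simp add: p_def Z_def)
  then have p_summable: "p summable_on UNIV"
    by (rule has_sum_imp_summable)
  have a_nonneg: "a y q \<ge> 0" for y q
    by (simp add: a_def split: prod.split)
  have c_nonneg: "c q \<ge> 0" for q
    using assms by (simp add: c_def split: prod.split)
  \<comment> \<open>Dropping the positive summand \<open>y * real (Suc m)\<close> from the
    denominator leaves exactly \<open>p\<close>.\<close>
  have a_le_p: "a y q \<le> p q" if "y > 0" for y q
  proof (cases q)
    case (Pair m n)
    have "(real (Suc n))\<^sup>2 \<le> (y * real (Suc m) + real (Suc n))\<^sup>2"
      using that by (intro power_mono) auto
    then have "1 / (y * real (Suc m) + real (Suc n))\<^sup>2 \<le> 1 / (real (Suc n))\<^sup>2"
      by (intro divide_left_mono) (use that in \<open>auto intro!: mult_pos_pos add_pos_pos zero_less_power\<close>)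
    then have "1 / (y * real (Suc m) + real (Suc n))\<^sup>2 / (real (Suc m))\<^sup>2 \<le> 1 / (real (Suc n))\<^sup>2 / (real (Suc m))\<^sup>2"
      by (rule divide_right_mono) simp
    then show ?thesis
      by (simp add: Pair a_def p_def mult.commute)
  qed
  have a_summable: "a y summable_on UNIV" if "y > 0" for y
    by (rule summable_on_comparison_test[OF p_summable]) (use that a_le_p a_nonneg in auto)
  \<comment> \<open>The swapped arguments in the second term make the denominators match:
    \<open>N / x + M\<close> is \<open>(N + M * x) / x\<close>. With \<open>D = N + M * x\<close>,
    this division by \<open>x\<close> is the source of the factor \<open>x\<^sup>2\<close> in the
    numerator.\<close>
  have termwise: "- a x (m, n) + a (1 / x) (n, m) + 2 / x * c (m, n) = p (m, n)" for m n
  proof -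
    have "- 1 / (x * M + N)\<^sup>2 / M\<^sup>2 + 1 / (1 / x * N + M)\<^sup>2 / N\<^sup>2
            + 2 / x * (M * x / (N * (N + M * x)) / M ^ 3) = 1 / (M\<^sup>2 * N\<^sup>2)"
      if "M > 0" "N > 0" for M N :: real
    proof -
      define D where "D = N + M * x"
      have "D > 0"
        using assms that by (simp add: D_def add_pos_pos)
      have "1 / x * N + M = D / x" "x * M + N = D"
        using assms by (simp_all add: D_def field_simps)
      then have "- 1 / (x * M + N)\<^sup>2 / M\<^sup>2 + 1 / (1 / x * N + M)\<^sup>2 / N\<^sup>2
            + 2 / x * (M * x / (N * (N + M * x)) / M ^ 3)
          = - 1 / D\<^sup>2 / M\<^sup>2 + 1 / (D / x)\<^sup>2 / N\<^sup>2 + 2 / x * (M * x / (N * D) / M ^ 3)"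
        by (simp only: D_def)
      also have "\<dots> = (- N\<^sup>2 + x\<^sup>2 * M\<^sup>2 + 2 * N * D) / (D\<^sup>2 * M\<^sup>2 * N\<^sup>2)"
        using \<open>D > 0\<close> assms that by (simp add: field_simps power2_eq_square power3_eq_cube)
      also have "- N\<^sup>2 + x\<^sup>2 * M\<^sup>2 + 2 * N * D = D\<^sup>2"
        by (simp add: D_def power2_eq_square algebra_simps)
      also have "D\<^sup>2 / (D\<^sup>2 * M\<^sup>2 * N\<^sup>2) = 1 / (M\<^sup>2 * N\<^sup>2)"
        using \<open>D > 0\<close> by simp
      finally show ?thesis .
    qed
    from this[of "real (Suc m)" "real (Suc n)"] show ?thesis
      by (simp add: a_def c_def p_def)
  qed
  have a_swap: "((\<lambda>(m, n). a (1 / x) (n, m)) has_sum infsum (a (1 / x)) UNIV) UNIV"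
  proof -
    have "(a (1 / x) has_sum infsum (a (1 / x)) UNIV) (range prod.swap)"
      using assms by (simp add: a_summable)
    then have "(a (1 / x) \<circ> prod.swap has_sum infsum (a (1 / x)) UNIV) UNIV"
      by (subst (asm) has_sum_reindex) auto
    then show ?thesis
      by (simp add: o_def case_prod_unfold prod.swap_def)
  qed
  \<comment> \<open>Solving the termwise identity for \<open>c\<close> yields both its summability
    and its sum from \<open>p\<close> and the two families \<open>a\<close>, so \<open>c\<close>
    needs no majorant of its own.\<close>
  have c_eq: "c = (\<lambda>q. x / 2 * (p q + a x q - (case q of (m, n) \<Rightarrow> a (1 / x) (n, m))))"
  proof
    fix q
    show "c q = x / 2 * (p q + a x q - (case q of (m, n) \<Rightarrow> a (1 / x) (n, m)))"
      using termwise[of "fst q" "snd q"] assms by (cases q) (simp add: field_simps)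
  qed
  have c: "(c has_sum x / 2 * (Z\<^sup>2 + infsum (a x) UNIV - infsum (a (1 / x)) UNIV)) UNIV"
    unfolding c_eq diff_conv_add_uminus
    by (intro has_sum_cmult_right has_sum_add p has_sum_infsum a_summable assms)
       (simp add: has_sum_uminus a_swap)
  have a_sums: "(\<lambda>m. deriv Digamma (real (Suc m) * y + 1) / (real (Suc m))\<^sup>2) sums infsum (a y) UNIV"
    if "y > 0" for y
  proof (rule row_sums_sums_infsum[OF a_summable[OF that] a_nonneg])
    show "(\<lambda>n. a y (m, n)) sums (deriv Digamma (real (Suc m) * y + 1) / (real (Suc m))\<^sup>2)" for m
      using sums_divide[OF deriv_Digamma_sums[of "real (Suc m) * y"], of "(real (Suc m))\<^sup>2"] that
      by (simp add: a_def mult.commute)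
  qed
  have c_sums: "(\<lambda>m. (euler_mascheroni + Digamma (real (Suc m) * x + 1)) / real (Suc m) ^ 3) sums infsum c UNIV"
  proof (rule row_sums_sums_infsum[OF has_sum_imp_summable[OF c] c_nonneg])
    show "(\<lambda>n. c (m, n)) sums ((euler_mascheroni + Digamma (real (Suc m) * x + 1)) / real (Suc m) ^ 3)" for m
      using sums_divide[OF euler_mascheroni_plus_Digamma_sums[of "real (Suc m) * x"], of "real (Suc m) ^ 3"] assms
      by (simp add: c_def)
  qed
  have b_sums: "(\<lambda>m. deriv Digamma (real (Suc m) / x + 1) / (real (Suc m))\<^sup>2) sums infsum (a (1 / x)) UNIV"
    using a_sums[of "1 / x"] assms by simp
  \<comment> \<open>The factor \<open>2 / x\<close> undoes the \<open>x / 2\<close> in the sum of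
    \<open>c\<close>, and the sums of \<open>a x\<close> and \<open>a (1 / x)\<close>
    cancel.\<close>
  have "- infsum (a x) UNIV + infsum (a (1 / x)) UNIV + 2 / x * infsum c UNIV = Z\<^sup>2"
    unfolding infsumI[OF c] using assms by (simp add: field_simps)
  then show ?thesis
    using a_sums[OF assms] b_sums c_sums by (simp add: sums_iff zeta_2_eq Z_def)
qed

end
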